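(* In the risk model described in the context, suppose that the claim surplus process $S(t)=\sum_{j=1}^{N(t)}Z(T_j)-p(t)$, $t\ge0$, is a separable process with independent increments. Then for any $u>0$ and any $T,h\ge 0$, $$\psi(u,T)=\mathbf{P}\Big(\sup_{0\le t\le T}S(t)>u\Big)\le e^{-hu}\sup_{0\le t\le T}\mathbf{E}e^{hS(t)}.$$ In addition, for any $u>0$ and $h\ge 0$, $$\psi(u)=\mathbf{P}\Big(\sup_{t\ge 0}S(t)>u\Big)\le e^{-hu}\sup_{t\ge 0}\mathbf{E}e^{hS(t)}.$$
   Context: Model A: $N(t)$, $t\ge 0$, is a non-homogeneous Poisson process with non-decreasing accumulated intensity function $\Lambda(t)=\mathbf{E}N(t)<\infty$, $N(0)=\Lambda(0)=0$. $T_j=\min\{t\ge 0:N(t)\ge j\}$ are the claim times. $Z(t)\ge 0$ denotes the claim size in case a claim arrives at time $t$; the processes $N(\cdot)$ and $Z(\cdot)$ are independent, and the claim sizes $Z(T_j)$, $j\ge 1$, are independent but not necessarily identically distributed. The function $p(t)\ge 0$ is the aggregate premium income over $[0,t]$, assumed non-decreasing. The risk reserve process is $R(t)=u+p(t)-\sum_{j=1}^{N(t)}Z(T_j)=u-S(t)$ with initial reserve $R(0)=u>0$ (so $p(0)=0$ and $S(0)=0$). The ruin probabilities are $\psi(u)=\mathbf{P}(\inf_{t\ge 0}R(t)<0)$ and $\psi(u,T)=\mathbf{P}(\inf_{0\le t\le T}R(t)<0)$. Separable is meant in Doob's sense. Exponential moments may equal $+\infty$. *)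

theory Defs
  imports "HOL-Probability.Probability"
begin

text \<open>Stochastic processes are indexed by the time set $[0,\infty)$, encoded as the half-line
  \<open>{0..}\<close> of the reals; values at negative times are irrelevant.\<close>

definition independent_increments :: "'a measure \<Rightarrow> (real \<Rightarrow> 'a \<Rightarrow> real) \<Rightarrow> bool" where
  "independent_increments M X \<longleftrightarrow>
     (\<forall>n (t :: nat \<Rightarrow> real). 0 \<le> t 0 \<and> (\<forall>i<n. t i < t (Suc i)) \<longrightarrow>
        prob_space.indep_vars M (\<lambda>_. borel) (\<lambda>i \<omega>. X (t (Suc i)) \<omega> - X (t i) \<omega>) {..<n})"

text \<open>Separability in Doob's sense (relative to the closed intervals, bounded or not): off one null
  set \<open>Q\<close>, the events that \<open>X\<close> stays in a closed interval \<open>A\<close> during an open interval \<open>I\<close> of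
  times can be read off a countable set \<open>D\<close> of times. \<open>D\<close> and \<open>Q\<close> depend neither on \<open>I\<close> nor
  on \<open>A\<close>.\<close>

definition separable_process :: "'a measure \<Rightarrow> (real \<Rightarrow> 'a \<Rightarrow> real) \<Rightarrow> bool" where
  "separable_process M X \<longleftrightarrow>
     (\<forall>t\<ge>0. X t \<in> borel_measurable M) \<and>
     (\<exists>D Q. countable D \<and> D \<subseteq> {0..} \<and> Q \<in> null_sets M \<and>
        (\<forall>I A. open I \<and> is_interval I \<and> closed A \<and> is_interval A \<longrightarrow>
           (\<forall>\<omega>\<in>space M - Q.
              (\<forall>t\<in>I \<inter> D. X t \<omega> \<in> A) \<longleftrightarrow> (\<forall>t\<in>I \<inter> {0..}. X t \<omega> \<in> A))))"

text \<open>The law of the increments is written out instead of using \<^const>\<open>poisson_pmf\<close>, whose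
  rate must be positive, since \<open>\<Lambda> t = \<Lambda> s\<close> is allowed here.\<close>

definition nonhomogeneous_poisson_process ::
    "'a measure \<Rightarrow> (real \<Rightarrow> 'a \<Rightarrow> nat) \<Rightarrow> (real \<Rightarrow> real) \<Rightarrow> bool" where
  "nonhomogeneous_poisson_process M N \<Lambda> \<longleftrightarrow>
     (\<forall>t\<ge>0. N t \<in> measurable M (count_space UNIV)) \<and>
     (\<forall>\<omega>\<in>space M. N 0 \<omega> = 0 \<and> mono_on {0..} (\<lambda>t. N t \<omega>) \<and>
        (\<forall>t\<ge>0. continuous (at_right t) (\<lambda>s. N s \<omega>))) \<and>
     \<Lambda> 0 = 0 \<and> mono_on {0..} \<Lambda> \<and>
     (\<forall>t\<ge>0. (\<integral>\<^sup>+ \<omega>. of_nat (N t \<omega>) \<partial>M) = ennreal (\<Lambda> t)) \<and>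
     independent_increments M (\<lambda>t \<omega>. real (N t \<omega>)) \<and>
     (\<forall>s t k. 0 \<le> s \<and> s \<le> t \<longrightarrow>
        measure M {\<omega> \<in> space M. N t \<omega> - N s \<omega> = k} =
          (\<Lambda> t - \<Lambda> s) ^ k / fact k * exp (- (\<Lambda> t - \<Lambda> s)))"

definition claim_occurs :: "(real \<Rightarrow> 'a \<Rightarrow> nat) \<Rightarrow> nat \<Rightarrow> 'a \<Rightarrow> bool" where
  "claim_occurs N j \<omega> \<longleftrightarrow> (\<exists>t\<ge>0. j \<le> N t \<omega>)"

text \<open>By right-continuity of the paths of \<open>N\<close> the minimum is attained whenever the \<open>j\<close>-th claim
  occurs; otherwise the value is unspecified.\<close>

definition claim_time :: "(real \<Rightarrow> 'a \<Rightarrow> nat) \<Rightarrow> nat \<Rightarrow> 'a \<Rightarrow> real" where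
  "claim_time N j \<omega> = (LEAST t. 0 \<le> t \<and> j \<le> N t \<omega>)"

definition claim_size ::
    "(real \<Rightarrow> 'a \<Rightarrow> nat) \<Rightarrow> (real \<Rightarrow> 'a \<Rightarrow> real) \<Rightarrow> nat \<Rightarrow> 'a \<Rightarrow> real" where
  "claim_size N Z j \<omega> = (if claim_occurs N j \<omega> then Z (claim_time N j \<omega>) \<omega> else 0)"

text \<open>If \<open>\<Lambda>\<close> is bounded, the \<open>n\<close>-th claim may fail to occur. Independence of the claim sizes
  is therefore required for each initial segment \<open>{1..n}\<close>, given that the \<open>n\<close>-th claim occurs; when
  all claims occur almost surely this is independence of the whole sequence. Independence of the
  processes \<open>N\<close> and \<open>Z\<close> refers to the product sigma-algebras on their path spaces.\<close>

locale risk_model = prob_space M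
  for M :: "'a measure" and N :: "real \<Rightarrow> 'a \<Rightarrow> nat" and \<Lambda> :: "real \<Rightarrow> real"
    and Z :: "real \<Rightarrow> 'a \<Rightarrow> real" and p :: "real \<Rightarrow> real" +
  assumes poisson: "nonhomogeneous_poisson_process M N \<Lambda>"
    and size_nonneg: "\<And>t \<omega>. 0 \<le> t \<Longrightarrow> \<omega> \<in> space M \<Longrightarrow> 0 \<le> Z t \<omega>"
    and indep_N_Z: "indep_var
          (\<Pi>\<^sub>M t\<in>{0..}. count_space UNIV) (\<lambda>\<omega>. \<lambda>t\<in>{0..}. N t \<omega>)
          (\<Pi>\<^sub>M t\<in>{0..}. borel) (\<lambda>\<omega>. \<lambda>t\<in>{0..}. Z t \<omega>)"
    and size_measurable: "\<And>j. 1 \<le> j \<Longrightarrow> claim_size N Z j \<in> borel_measurable M"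
    and sizes_indep: "\<And>n. prob {\<omega> \<in> space M. claim_occurs N n \<omega>} > 0 \<Longrightarrow>
          prob_space.indep_vars (uniform_measure M {\<omega> \<in> space M. claim_occurs N n \<omega>})
            (\<lambda>_. borel) (claim_size N Z) {1..n}"
    and premium: "p 0 = 0" "mono_on {0..} p" "\<And>t. 0 \<le> t \<Longrightarrow> 0 \<le> p t"

definition risk_reserve :: "(real \<Rightarrow> 'a \<Rightarrow> nat) \<Rightarrow> (real \<Rightarrow> 'a \<Rightarrow> real) \<Rightarrow> (real \<Rightarrow> real) \<Rightarrow>
    real \<Rightarrow> real \<Rightarrow> 'a \<Rightarrow> real" where
  "risk_reserve N Z p u t \<omega> = u + p t - (\<Sum>j=1..N t \<omega>. Z (claim_time N j \<omega>) \<omega>)"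

definition claim_surplus :: "(real \<Rightarrow> 'a \<Rightarrow> nat) \<Rightarrow> (real \<Rightarrow> 'a \<Rightarrow> real) \<Rightarrow> (real \<Rightarrow> real) \<Rightarrow>
    real \<Rightarrow> 'a \<Rightarrow> real" where
  "claim_surplus N Z p t \<omega> = (\<Sum>j=1..N t \<omega>. Z (claim_time N j \<omega>) \<omega>) - p t"

text \<open>Infima and suprema over uncountable time sets need not be measurable with respect to \<open>M\<close>,
  but for a separable process the events below belong to the completion of \<open>M\<close> (see
  \<open>separable_sup_event\<close> and \<open>separable_ruin_event\<close>), so probabilities are taken there. Infima and
  suprema are extended real, since paths may be unbounded.\<close>

definition ruin_prob :: "'a measure \<Rightarrow> (real \<Rightarrow> 'a \<Rightarrow> nat) \<Rightarrow> (real \<Rightarrow> 'a \<Rightarrow> real) \<Rightarrow>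
    (real \<Rightarrow> real) \<Rightarrow> real \<Rightarrow> real" where
  "ruin_prob M N Z p u = measure (completion M)
     {\<omega> \<in> space M. (INF t\<in>{0..}. ereal (risk_reserve N Z p u t \<omega>)) < 0}"

definition finite_ruin_prob :: "'a measure \<Rightarrow> (real \<Rightarrow> 'a \<Rightarrow> nat) \<Rightarrow> (real \<Rightarrow> 'a \<Rightarrow> real) \<Rightarrow>
    (real \<Rightarrow> real) \<Rightarrow> real \<Rightarrow> real \<Rightarrow> real" where
  "finite_ruin_prob M N Z p u T = measure (completion M)
     {\<omega> \<in> space M. (INF t\<in>{0..T}. ereal (risk_reserve N Z p u t \<omega>)) < 0}"

lemma separable_sup_event:
  assumes sep: "separable_process M X" and J: "J = {0..} \<or> (\<exists>T\<ge>0. J = {0..T})"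
  shows "{\<omega> \<in> space M. (SUP t\<in>J. ereal (X t \<omega>)) > ereal u} \<in> sets (completion M)"
proof -
  from sep have meas: "\<And>t. t \<ge> 0 \<Longrightarrow> X t \<in> borel_measurable M"
    by (simp add: separable_process_def)
  from sep obtain D Q where D: "countable D" "D \<subseteq> {0..}" and Q: "Q \<in> null_sets M"
    and DQ: "\<forall>I A. open I \<and> is_interval I \<and> closed A \<and> is_interval A \<longrightarrow>
       (\<forall>\<omega>\<in>space M - Q. (\<forall>t\<in>I \<inter> D. X t \<omega> \<in> A) \<longleftrightarrow> (\<forall>t\<in>I \<inter> {0..}. X t \<omega> \<in> A))"
    unfolding separable_process_def by (elim conjE exE)
  obtain I E where I: "open I" "is_interval I" and E: "finite E" "E \<subseteq> {0..}"
    and JE: "J = I \<inter> {0..} \<union> E"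
  proof (cases "J = {0..}")
    case True then show ?thesis using that[of UNIV "{}"] by simp
  next
    case False
    then obtain T where T: "T \<ge> 0" "J = {0..T}" using J by blast
    have "J = {..<T} \<inter> {0..} \<union> {T}" using T by auto
    then show ?thesis using that[of "{..<T}" "{T}"] T by (simp add: is_interval_1)
  qed
  define K where "K = I \<inter> D \<union> E"
  have K: "countable K" "K \<subseteq> {0..}"
    using D E by (auto simp: K_def countable_finite)
  define B where "B = (\<Union>t\<in>K. {\<omega> \<in> space M. X t \<omega> > u})"
  have "B \<in> sets M" unfolding B_def
  proof (rule sets.countable_UN''[OF K(1)])
    fix t assume "t \<in> K"
    then have "X t \<in> borel_measurable M" using K meas by auto
    then show "{\<omega> \<in> space M. X t \<omega> > u} \<in> sets M" by simp
  qed
  let ?A = "{\<omega> \<in> space M. (SUP t\<in>J. ereal (X t \<omega>)) > ereal u}"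
  have "\<omega> \<in> ?A \<longleftrightarrow> \<omega> \<in> B" if \<omega>: "\<omega> \<in> space M - Q" for \<omega>
  proof -
    have "is_interval {..u}" by (auto simp: is_interval_1)
    then have "(\<forall>t\<in>I \<inter> D. X t \<omega> \<in> {..u}) \<longleftrightarrow> (\<forall>t\<in>I \<inter> {0..}. X t \<omega> \<in> {..u})"
      using DQ I \<omega> closed_atMost[of u] by blast
    then have "(\<exists>t\<in>I \<inter> D. X t \<omega> > u) \<longleftrightarrow> (\<exists>t\<in>I \<inter> {0..}. X t \<omega> > u)"
      by (metis atMost_iff not_le)
    then show ?thesis using \<omega> by (simp add: less_SUP_iff B_def K_def JE bex_Un)
  qed
  moreover have "B \<subseteq> space M" "?A \<subseteq> space M"
    using sets.sets_into_space[OF \<open>B \<in> sets M\<close>] by auto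
  ultimately have eq: "?A = (B - Q) \<union> (?A \<inter> Q)" by (intro set_eqI) blast
  show ?thesis
  proof (rule sets_completionI[OF eq _ Q])
    show "?A \<inter> Q \<subseteq> Q" by (rule Int_lower2)
    show "B - Q \<in> sets M" using \<open>B \<in> sets M\<close> Q by (simp add: null_setsD2 sets.Diff)
  qed
qed

lemma separable_ruin_event:
  assumes "separable_process M (claim_surplus N Z p)" and "J = {0..} \<or> (\<exists>T\<ge>0. J = {0..T})"
  shows "{\<omega> \<in> space M. (INF t\<in>J. ereal (risk_reserve N Z p u t \<omega>)) < 0} \<in> sets (completion M)"
proof -
  have "risk_reserve N Z p u t \<omega> < 0 \<longleftrightarrow> claim_surplus N Z p t \<omega> > u" for t \<omega>
    by (auto simp: risk_reserve_def claim_surplus_def)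
  then have "(INF t\<in>J. ereal (risk_reserve N Z p u t \<omega>)) < 0 \<longleftrightarrow>
      (SUP t\<in>J. ereal (claim_surplus N Z p t \<omega>)) > ereal u" for \<omega>
    by (simp add: INF_less_iff less_SUP_iff)
  then show ?thesis using separable_sup_event[OF assms, of u] by simp
qed

end

theory Submission imports Defs begin

text \<open>Let \<open>m t\<close> be the expectation of \<open>exp (h * S t)\<close>. By independence of increments,
  \<open>exp (h * S t) / m t\<close> is a martingale with mean 1, so stopping it at the first passage of \<open>S\<close>
  above \<open>u\<close> bounds the passage probability by \<open>exp (- h * u)\<close> times the supremum of \<open>m\<close>. On a
  finite set of times this is a sum over the disjoint first-passage events; continuity of the
  measure passes to countable sets of times, and separability to intervals.\<close>

section \<open>Maximal inequality for partial sums of independent variables\<close>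

text \<open>The joint law is the product of the marginal laws, so Tonelli applies. Working with
  nonnegative integrals makes the product rule available for infinite exponential moments
  too.\<close>

lemma (in prob_space) indep_var_nn_integral_mult:
  assumes indep: "indep_var S X T Y"
    and f[measurable]: "f \<in> borel_measurable S" and g[measurable]: "g \<in> borel_measurable T"
  shows "(\<integral>\<^sup>+ \<omega>. f (X \<omega>) * g (Y \<omega>) \<partial>M) = (\<integral>\<^sup>+ \<omega>. f (X \<omega>) \<partial>M) * (\<integral>\<^sup>+ \<omega>. g (Y \<omega>) \<partial>M)"
proof -
  note [measurable] = indep_var_rv1[OF indep] indep_var_rv2[OF indep]
  interpret X: prob_space "distr M S X" by (rule prob_space_distr) simp
  interpret Y: prob_space "distr M T Y" by (rule prob_space_distr) simp
  have "(\<integral>\<^sup>+ \<omega>. f (X \<omega>) * g (Y \<omega>) \<partial>M) =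
      (\<integral>\<^sup>+ z. f (fst z) * g (snd z) \<partial>distr M (S \<Otimes>\<^sub>M T) (\<lambda>\<omega>. (X \<omega>, Y \<omega>)))"
    by (subst nn_integral_distr) auto
  also have "\<dots> = (\<integral>\<^sup>+ z. f (fst z) * g (snd z) \<partial>(distr M S X \<Otimes>\<^sub>M distr M T Y))"
    using indep by (simp add: indep_var_distribution_eq)
  also have "\<dots> = (\<integral>\<^sup>+ x. \<integral>\<^sup>+ y. f x * g y \<partial>distr M T Y \<partial>distr M S X)"
    by (subst Y.nn_integral_fst[symmetric]) auto
  also have "\<dots> = (\<integral>\<^sup>+ x. f x \<partial>distr M S X) * (\<integral>\<^sup>+ y. g y \<partial>distr M T Y)"
    by (simp add: nn_integral_cmult nn_integral_multc)
  also have "\<dots> = (\<integral>\<^sup>+ \<omega>. f (X \<omega>) \<partial>M) * (\<integral>\<^sup>+ \<omega>. g (Y \<omega>) \<partial>M)"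
    by (simp add: nn_integral_distr)
  finally show ?thesis .
qed

text \<open>Passage over \<open>u\<close> is split by its first index \<open>k\<close>. With
  \<open>r k\<close> the exponential moment of the increments still to come,
  \<open>exp (h * u) * P(A k) * r k\<close> is at most the integral of \<open>exp (h * s n)\<close>
  over \<open>A k\<close>. Since \<open>m n \<le> C * r k\<close>, summing over \<open>k\<close>
  leaves a factor \<open>m n\<close> on both sides, which cancels.\<close>

lemma (in prob_space) partial_sums_exponential_maximal_inequality:
  fixes Y :: "nat \<Rightarrow> 'a \<Rightarrow> real"
  assumes indep: "indep_vars (\<lambda>_. borel) Y {..<n}" and h: "0 \<le> h"
    and C: "\<And>k. k \<le> n \<Longrightarrow> (\<integral>\<^sup>+ \<omega>. ennreal (exp (h * (\<Sum>i<k. Y i \<omega>))) \<partial>M) \<le> C"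
  shows "emeasure M {\<omega> \<in> space M. \<exists>k\<le>n. u < (\<Sum>i<k. Y i \<omega>)} \<le> ennreal (exp (- h * u)) * C"
proof (cases "C = \<infinity>")
  case True
  \<comment> \<open>The factor \<open>exp (- h * u)\<close> is positive, so the right side is
    infinite.\<close>
  then show ?thesis by (simp add: ennreal_mult_top)
next
  case False
  define s where "s k \<omega> = (\<Sum>i<k. Y i \<omega>)" for k \<omega>
  \<comment> \<open>First passage at index \<open>k\<close>. Index 0 counts as well:
    \<open>s 0\<close> is the empty sum, and \<open>u\<close> may be negative here.\<close>
  define A where "A k = {\<omega> \<in> space M. u < s k \<omega> \<and> (\<forall>j<k. s j \<omega> \<le> u)}" for k
  define m where "m k = (\<integral>\<^sup>+ \<omega>. ennreal (exp (h * s k \<omega>)) \<partial>M)" for k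
  define r where "r k = (\<integral>\<^sup>+ \<omega>. ennreal (exp (h * (\<Sum>i\<in>{k..<n}. Y i \<omega>))) \<partial>M)" for k
  have Y[measurable]: "Y i \<in> borel_measurable M" if "i < n" for i
    using indep that by (auto simp: indep_vars_def)
  have s[measurable]: "s k \<in> borel_measurable M" if "k \<le> n" for k
    unfolding s_def[abs_def] using that by (intro borel_measurable_sum) auto
  have A[measurable]: "A k \<in> sets M" if k: "k \<le> n" for k
  proof -
    have "A k = {\<omega> \<in> space M. u < s k \<omega> \<and> (\<forall>j\<in>{..<k}. s j \<omega> \<le> u)}"
      by (auto simp: A_def)
    also have "\<dots> \<in> sets M"
      using k by (intro sets.sets_Collect_conj sets.sets_Collect_finite_All borel_measurable_less
          borel_measurable_le borel_measurable_const s) auto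
    finally show ?thesis .
  qed
  \<comment> \<open>The weight \<open>f\<close> sees only the first \<open>k\<close> increments, so
    together with \<open>exp (h * s k)\<close> it is independent of the block
    \<open>{k..<n}\<close>, whose moment \<open>r k\<close> splits off.\<close>
  have factor: "(\<integral>\<^sup>+ \<omega>. ennreal (exp (h * s n \<omega>)) * f (restrict (\<lambda>i. Y i \<omega>) {..<k}) \<partial>M) =
      (\<integral>\<^sup>+ \<omega>. ennreal (exp (h * s k \<omega>)) * f (restrict (\<lambda>i. Y i \<omega>) {..<k}) \<partial>M) * r k"
    if k: "k \<le> n" and f[measurable]: "f \<in> borel_measurable (PiM {..<k} (\<lambda>_. borel))"
    for k and f :: "(nat \<Rightarrow> real) \<Rightarrow> ennreal"
  proof -
    have "indep_var (PiM {..<k} (\<lambda>_. borel)) (\<lambda>\<omega>. restrict (\<lambda>i. Y i \<omega>) {..<k})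
        (PiM {k..<n} (\<lambda>_. borel)) (\<lambda>\<omega>. restrict (\<lambda>i. Y i \<omega>) {k..<n})"
      using k by (intro indep_var_restrict[OF indep]) auto
    note this[THEN indep_var_nn_integral_mult,
        of "\<lambda>x. ennreal (exp (h * (\<Sum>i<k. x i))) * f x" "\<lambda>x. ennreal (exp (h * (\<Sum>i\<in>{k..<n}. x i)))"]
    then have *: "(\<integral>\<^sup>+ \<omega>. ennreal (exp (h * s k \<omega>)) * f (restrict (\<lambda>i. Y i \<omega>) {..<k}) *
        ennreal (exp (h * (\<Sum>i\<in>{k..<n}. Y i \<omega>))) \<partial>M) =
      (\<integral>\<^sup>+ \<omega>. ennreal (exp (h * s k \<omega>)) * f (restrict (\<lambda>i. Y i \<omega>) {..<k}) \<partial>M) * r k"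
      by (simp add: s_def r_def)
    have "s n \<omega> = s k \<omega> + (\<Sum>i\<in>{k..<n}. Y i \<omega>)" for \<omega>
      using k sum.atLeastLessThan_concat[of 0 k n "\<lambda>i. Y i \<omega>"]
      by (simp add: s_def atLeast0LessThan)
    then have "ennreal (exp (h * s n \<omega>)) * c =
        ennreal (exp (h * s k \<omega>)) * c * ennreal (exp (h * (\<Sum>i\<in>{k..<n}. Y i \<omega>)))" for \<omega> c
      by (simp add: distrib_left exp_add ennreal_mult mult_ac)
    with * show ?thesis by simp
  qed
  have mn: "m n = m k * r k" if "k \<le> n" for k
    using factor[OF that, of "\<lambda>_. 1"] by (simp add: m_def)
  \<comment> \<open>The optional stopping step at time \<open>k\<close>. Working with \<open>r k\<close> instead of \<open>m n / m k\<close>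
    avoids division in \<^typ>\<open>ennreal\<close>.\<close>
  have passage: "ennreal (exp (h * u)) * emeasure M (A k) * r k \<le>
      (\<integral>\<^sup>+ \<omega>. ennreal (exp (h * s n \<omega>)) * indicator (A k) \<omega> \<partial>M)" if k: "k \<le> n" for k
  proof -
    \<comment> \<open>\<open>A k\<close> is pulled back to the path space of the first
      \<open>k\<close> increments, so that its indicator can serve as the weight \<open>f\<close> in
      \<open>factor\<close>.\<close>
    let ?P = "\<lambda>x :: nat \<Rightarrow> real. u < (\<Sum>i<k. x i) \<and> (\<forall>j\<in>{..<k}. (\<Sum>i<j. x i) \<le> u)"
    let ?B = "{x \<in> space (PiM {..<k} (\<lambda>_. borel)). ?P x}"
    have sums: "(\<lambda>x. \<Sum>i<j. x i) \<in> borel_measurable (PiM {..<k} (\<lambda>_. borel :: real measure))"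
      if "j \<le> k" for j
      using that by (intro borel_measurable_sum measurable_component_singleton) auto
    have B: "?B \<in> sets (PiM {..<k} (\<lambda>_. borel))"
      by (intro sets.sets_Collect_conj sets.sets_Collect_finite_All borel_measurable_less
          borel_measurable_le borel_measurable_const sums) auto
    have ind: "indicator ?B (restrict (\<lambda>i. Y i \<omega>) {..<k}) = (indicator (A k) \<omega> :: ennreal)"
      if "\<omega> \<in> space M" for \<omega>
    proof -
      have "(\<Sum>i<j. restrict (\<lambda>i. Y i \<omega>) {..<k} i) = s j \<omega>" if "j \<le> k" for j
        using that by (auto simp: s_def intro!: sum.cong)
      then show ?thesis
        using that by (auto simp: A_def space_PiM indicator_def)
    qed
    have "ennreal (exp (h * u)) * emeasure M (A k) = (\<integral>\<^sup>+ \<omega>. ennreal (exp (h * u)) * indicator (A k) \<omega> \<partial>M)"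
      using A[OF k] by (simp add: nn_integral_cmult_indicator)
    \<comment> \<open>On \<open>A k\<close> the sum \<open>s k\<close> exceeds \<open>u\<close>, and
      \<open>h \<ge> 0\<close> preserves the order under \<open>exp\<close>.\<close>
    also have "\<dots> \<le> (\<integral>\<^sup>+ \<omega>. ennreal (exp (h * s k \<omega>)) * indicator (A k) \<omega> \<partial>M)"
      using h by (intro nn_integral_mono) (auto simp: A_def indicator_def mult_left_mono)
    finally have "ennreal (exp (h * u)) * emeasure M (A k) * r k \<le>
        (\<integral>\<^sup>+ \<omega>. ennreal (exp (h * s k \<omega>)) * indicator (A k) \<omega> \<partial>M) * r k"
      by (rule mult_right_mono) simp
    also have "\<dots> = (\<integral>\<^sup>+ \<omega>. ennreal (exp (h * s n \<omega>)) * indicator (A k) \<omega> \<partial>M)"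
      using factor[OF k, of "indicator ?B"] B by (simp add: ind cong: nn_integral_cong)
    finally show ?thesis .
  qed
  have disj: "disjoint_family_on A {..n}"
    unfolding disjoint_family_on_def A_def by (auto simp: nat_neq_iff)
  have union: "{\<omega> \<in> space M. \<exists>k\<le>n. u < s k \<omega>} = (\<Union>k\<in>{..n}. A k)"
  proof (intro set_eqI iffI)
    fix \<omega> assume \<omega>: "\<omega> \<in> {\<omega> \<in> space M. \<exists>k\<le>n. u < s k \<omega>}"
    then obtain k where k: "k \<le> n" "u < s k \<omega>" by blast
    \<comment> \<open>The first passage may come before the given \<open>k\<close>, hence is still
      at most \<open>n\<close>.\<close>
    let ?l = "LEAST k. u < s k \<omega>"
    have "u < s ?l \<omega>" by (rule LeastI) (fact k)
    moreover have "?l \<le> n" using Least_le[of "\<lambda>k. u < s k \<omega>", OF k(2)] k(1) by (rule order_trans)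
    moreover have "s j \<omega> \<le> u" if "j < ?l" for j using not_less_Least[OF that] by simp
    ultimately show "\<omega> \<in> (\<Union>k\<in>{..n}. A k)" using \<omega> by (auto simp: A_def)
  qed (auto simp: A_def)
  have sub: "(\<Sum>k\<le>n. indicator (A k) \<omega>) \<le> (1::ennreal)" for \<omega>
  proof -
    have "(\<Sum>k\<le>n. indicator (A k) \<omega>) = (indicator (\<Union>k\<in>{..n}. A k) \<omega> :: ennreal)"
      by (rule indicator_UN_disjoint[OF finite_atMost disj, symmetric])
    then show ?thesis by (simp add: indicator_def)
  qed
  \<comment> \<open>Both sides carry the factor \<open>m n\<close>: on the left it is split as
    \<open>m k * r k\<close> with \<open>m k \<le> C\<close>, on the right it bounds the total over
    the disjoint events.\<close>
  have "ennreal (exp (h * u)) * emeasure M (\<Union>k\<in>{..n}. A k) * m n =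
      (\<Sum>k\<le>n. ennreal (exp (h * u)) * emeasure M (A k) * m n)"
    using A disj by (subst sum_emeasure[symmetric]) (auto simp: sum_distrib_left sum_distrib_right)
  also have "\<dots> \<le> (\<Sum>k\<le>n. C * (ennreal (exp (h * u)) * emeasure M (A k) * r k))"
  proof (rule sum_mono)
    fix k assume "k \<in> {..n}"
    then have "m n \<le> C * r k" using mn[of k] C[of k] by (auto simp: m_def s_def intro: mult_right_mono)
    then show "ennreal (exp (h * u)) * emeasure M (A k) * m n \<le>
        C * (ennreal (exp (h * u)) * emeasure M (A k) * r k)"
      by (metis mult.left_commute mult_left_mono zero_le)
  qed
  also have "\<dots> \<le> C * (\<Sum>k\<le>n. \<integral>\<^sup>+ \<omega>. ennreal (exp (h * s n \<omega>)) * indicator (A k) \<omega> \<partial>M)"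
    unfolding sum_distrib_left[symmetric] by (intro mult_left_mono sum_mono passage) auto
  also have "(\<Sum>k\<le>n. \<integral>\<^sup>+ \<omega>. ennreal (exp (h * s n \<omega>)) * indicator (A k) \<omega> \<partial>M) =
      (\<integral>\<^sup>+ \<omega>. ennreal (exp (h * s n \<omega>)) * (\<Sum>k\<le>n. indicator (A k) \<omega>) \<partial>M)"
    using A s[of n] by (subst nn_integral_sum[symmetric]) (auto simp: sum_distrib_left)
  also have "\<dots> \<le> m n"
    unfolding m_def using sub by (intro nn_integral_mono) (metis mult.right_neutral mult_left_mono zero_le)
  finally have le: "ennreal (exp (h * u)) * emeasure M (\<Union>k\<in>{..n}. A k) * m n \<le> C * m n"
    by (simp add: mult_left_mono)
  \<comment> \<open>Cancelling \<open>m n\<close> requires it to be positive and finite: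
    \<open>exp\<close> vanishes nowhere and the space has mass 1, while \<open>m n \<le> C\<close>
    and \<open>C\<close> is finite in this case.\<close>
  have "m n \<noteq> 0"
    using s[of n] not_AE_zero_ennreal_E
    by (auto simp: m_def nn_integral_0_iff_AE ennreal_eq_0_iff not_le)
  moreover have "m n < \<infinity>"
    using C[of n] False by (auto simp: m_def s_def less_top top_unique)
  ultimately have "ennreal (exp (h * u)) * emeasure M (\<Union>k\<in>{..n}. A k) \<le> C"
    using le by (metis ennreal_mult_le_mult_iff infinity_ennreal_def less_irrefl mult.commute)
  then have "ennreal (exp (- h * u)) * (ennreal (exp (h * u)) * emeasure M (\<Union>k\<in>{..n}. A k))
      \<le> ennreal (exp (- h * u)) * C"
    by (rule mult_left_mono) simp
  moreover have "ennreal (exp (- h * u)) * ennreal (exp (h * u)) = 1"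
    by (simp add: ennreal_mult[symmetric] exp_add[symmetric])
  ultimately show ?thesis
    unfolding union[unfolded s_def] by (simp add: mult.assoc[symmetric])
qed

section \<open>From partial sums to finite, countable and interval time sets\<close>

text \<open>Listing the times in increasing order from 0 turns the values of \<open>X\<close> into
  partial sums of independent increments. All these times lie in \<open>J\<close>, so the supremum
  over \<open>J\<close> serves as the constant \<open>C\<close>.\<close>

lemma (in prob_space) finite_exponential_maximal_inequality:
  fixes X :: "real \<Rightarrow> 'a \<Rightarrow> real"
  assumes incr: "independent_increments M X" and X0: "\<And>\<omega>. \<omega> \<in> space M \<Longrightarrow> X 0 \<omega> = 0"
    and F: "finite F" "F \<subseteq> J" and J: "J \<subseteq> {0..}" "0 \<in> J" and h: "0 \<le> h"
  shows "emeasure M {\<omega> \<in> space M. \<exists>t\<in>F. u < X t \<omega>} \<le>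
    ennreal (exp (- h * u)) * (SUP t\<in>J. \<integral>\<^sup>+ \<omega>. ennreal (exp (h * X t \<omega>)) \<partial>M)"
proof -
  \<comment> \<open>Time 0 is added so that the increments add up to \<open>X\<close> itself. The
    list has \<open>n + 1\<close> times and therefore \<open>n\<close> increments.\<close>
  define l where "l = sorted_list_of_set (insert 0 F)"
  define n where "n = length l - 1"
  have l: "set l = insert 0 F" "sorted_wrt (<) l"
    using F by (simp_all add: l_def del: sorted_list_of_set_insert_remove)
  have len: "length l = Suc n"
    using l(1) by (cases l) (auto simp: n_def)
  have less: "l ! i < l ! Suc i" if "i < n" for i
    using sorted_wrt_nth_less[OF l(2), of i "Suc i"] that len by simp
  have inJ: "l ! i \<in> J" if "i \<le> n" for i
    using nth_mem[of i l] that len l(1) F J by auto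
  \<comment> \<open>All listed times lie in \<open>J\<close> and are nonnegative, so the added 0
    must come first.\<close>
  have l0: "l ! 0 = 0"
  proof -
    obtain j where j: "j < length l" "l ! j = 0" using l(1) by (metis in_set_conv_nth insertI1)
    show ?thesis
      using sorted_wrt_nth_less[OF l(2), of 0 j] j inJ[of 0] J by (cases "j = 0") auto
  qed
  let ?Y = "\<lambda>i \<omega>. X (l ! Suc i) \<omega> - X (l ! i) \<omega>"
  have indep: "indep_vars (\<lambda>_. borel) ?Y {..<n}"
    using incr[unfolded independent_increments_def, rule_format, of "\<lambda>i. l ! i" n] less l0 by simp
  have tele: "(\<Sum>i<k. ?Y i \<omega>) = X (l ! k) \<omega>" if "\<omega> \<in> space M" for k \<omega>
    using sum_lessThan_telescope[of "\<lambda>i. X (l ! i) \<omega>" k] that by (simp add: l0 X0)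
  let ?C = "SUP t\<in>J. \<integral>\<^sup>+ \<omega>. ennreal (exp (h * X t \<omega>)) \<partial>M"
  have C: "(\<integral>\<^sup>+ \<omega>. ennreal (exp (h * (\<Sum>i<k. ?Y i \<omega>))) \<partial>M) \<le> ?C" if "k \<le> n" for k
    using inJ[OF that] by (simp add: tele cong: nn_integral_cong) (rule SUP_upper)
  have Y: "?Y i \<in> borel_measurable M" if "i < n" for i
    using indep that by (auto simp: indep_vars_def)
  have "{\<omega> \<in> space M. \<exists>t\<in>F. u < X t \<omega>} \<subseteq> {\<omega> \<in> space M. \<exists>k\<le>n. u < (\<Sum>i<k. ?Y i \<omega>)}"
  proof safe
    fix \<omega> t assume "\<omega> \<in> space M" "t \<in> F" "u < X t \<omega>"
    moreover from \<open>t \<in> F\<close> obtain k where "k \<le> n" "l ! k = t"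
      using l(1) len by (metis in_set_conv_nth insertCI less_Suc_eq_le)
    ultimately show "\<exists>k\<le>n. u < (\<Sum>i<k. ?Y i \<omega>)"
      by (intro exI[of _ k]) (simp add: tele)
  qed
  moreover have "{\<omega> \<in> space M. \<exists>k\<le>n. u < (\<Sum>i<k. ?Y i \<omega>)} \<in> sets M"
  proof -
    have "{\<omega> \<in> space M. \<exists>k\<in>{..n}. u < (\<Sum>i<k. ?Y i \<omega>)} \<in> sets M"
      by (intro sets.sets_Collect_finite_Ex borel_measurable_less borel_measurable_const
          borel_measurable_sum Y) auto
    then show ?thesis by (simp only: Bex_def atMost_iff)
  qed
  ultimately have "emeasure M {\<omega> \<in> space M. \<exists>t\<in>F. u < X t \<omega>} \<le>
      emeasure M {\<omega> \<in> space M. \<exists>k\<le>n. u < (\<Sum>i<k. ?Y i \<omega>)}"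
    by (rule emeasure_mono)
  also have "\<dots> \<le> ennreal (exp (- h * u)) * ?C"
    by (rule partial_sums_exponential_maximal_inequality[OF indep h C])
  finally show ?thesis .
qed

text \<open>The bound for finite sets depends only on \<open>J\<close>, so it survives the
  increasing limit over finite parts of \<open>K\<close>.\<close>

lemma (in prob_space) countable_exponential_maximal_inequality:
  fixes X :: "real \<Rightarrow> 'a \<Rightarrow> real"
  assumes incr: "independent_increments M X" and X0: "\<And>\<omega>. \<omega> \<in> space M \<Longrightarrow> X 0 \<omega> = 0"
    and X: "\<And>t. t \<in> K \<Longrightarrow> X t \<in> borel_measurable M"
    and K: "countable K" "K \<subseteq> J" and J: "J \<subseteq> {0..}" "0 \<in> J" and h: "0 \<le> h"
  shows "emeasure M {\<omega> \<in> space M. \<exists>t\<in>K. u < X t \<omega>} \<le>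
    ennreal (exp (- h * u)) * (SUP t\<in>J. \<integral>\<^sup>+ \<omega>. ennreal (exp (h * X t \<omega>)) \<partial>M)"
proof (cases "K = {}")
  case False
  \<comment> \<open>Passage at one of the first \<open>n\<close> enumerated times.
    \<open>from_nat_into\<close> repeats elements when \<open>K\<close> is finite, which is harmless
    for a union.\<close>
  define B where "B n = {\<omega> \<in> space M. \<exists>t\<in>from_nat_into K ` {..<n}. u < X t \<omega>}" for n :: nat
  have "B n \<in> sets M" for n
    unfolding B_def using from_nat_into[OF False]
    by (intro sets.sets_Collect_finite_Ex borel_measurable_less borel_measurable_const X) auto
  then have sup: "(SUP n. emeasure M (B n)) = emeasure M (\<Union>n. B n)"
    by (intro SUP_emeasure_incseq) (auto simp: B_def incseq_def)
  have union: "(\<Union>n. B n) = {\<omega> \<in> space M. \<exists>t\<in>K. u < X t \<omega>}"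
  proof -
    have "(\<Union>n. from_nat_into K ` {..<n}) = K"
      using range_from_nat_into[OF False K(1)] by auto
    then show ?thesis unfolding B_def by blast
  qed
  have le: "emeasure M (B n) \<le>
      ennreal (exp (- h * u)) * (SUP t\<in>J. \<integral>\<^sup>+ \<omega>. ennreal (exp (h * X t \<omega>)) \<partial>M)" for n
    unfolding B_def using from_nat_into[OF False] K
    by (intro finite_exponential_maximal_inequality incr X0 J h) auto
  show ?thesis unfolding union[symmetric] sup[symmetric] by (intro SUP_least le)
qed simp

text \<open>Off the null set \<open>Q\<close>, passage over \<open>u\<close> during \<open>J\<close>
  already happens at a time of a countable \<open>K\<close>, where the previous bound
  applies.\<close>

lemma (in prob_space) separable_exponential_maximal_inequality:
  fixes X :: "real \<Rightarrow> 'a \<Rightarrow> real"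
  assumes sep: "separable_process M X" and incr: "independent_increments M X"
    and X0: "\<And>\<omega>. \<omega> \<in> space M \<Longrightarrow> X 0 \<omega> = 0"
    and J: "J = {0..} \<or> (\<exists>T\<ge>0. J = {0..T})" and h: "0 \<le> h"
  shows "emeasure (completion M) {\<omega> \<in> space M. (SUP t\<in>J. ereal (X t \<omega>)) > ereal u} \<le>
    ennreal (exp (- h * u)) * (SUP t\<in>J. \<integral>\<^sup>+ \<omega>. ennreal (exp (h * X t \<omega>)) \<partial>M)"
proof -
  from sep have meas: "\<And>t. t \<ge> 0 \<Longrightarrow> X t \<in> borel_measurable M"
    by (simp add: separable_process_def)
  from sep obtain D Q where D: "countable D" "D \<subseteq> {0..}" and Q: "Q \<in> null_sets M"
    and DQ: "\<forall>I A. open I \<and> is_interval I \<and> closed A \<and> is_interval A \<longrightarrow>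
       (\<forall>\<omega>\<in>space M - Q. (\<forall>t\<in>I \<inter> D. X t \<omega> \<in> A) \<longleftrightarrow> (\<forall>t\<in>I \<inter> {0..}. X t \<omega> \<in> A))"
    unfolding separable_process_def by (elim conjE exE)
  \<comment> \<open>Separability speaks of open intervals only, so \<open>{0..T}\<close> is cut into
    \<open>{..<T}\<close> within the half-line and the endpoint \<open>T\<close>, which joins
    \<open>K\<close> directly.\<close>
  obtain I E where I: "open I" "is_interval I" and E: "finite E"
    and JE: "J = I \<inter> {0..} \<union> E"
  proof (cases "J = {0..}")
    case True then show ?thesis using that[of UNIV "{}"] by simp
  next
    case False
    then obtain T where T: "T \<ge> 0" "J = {0..T}" using J by blast
    have "J = {..<T} \<inter> {0..} \<union> {T}" using T by auto
    then show ?thesis using that[of "{..<T}" "{T}"] by (simp add: is_interval_1)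
  qed
  define K where "K = I \<inter> D \<union> E"
  have J0: "J \<subseteq> {0..}" "0 \<in> J" using J by auto
  have K: "countable K" "K \<subseteq> J"
    using D E JE by (auto simp: K_def countable_finite)
  have XK: "X t \<in> borel_measurable M" if "t \<in> K" for t using meas K J0 that by auto
  let ?B = "{\<omega> \<in> space M. \<exists>t\<in>K. u < X t \<omega>}"
  have B: "?B \<in> sets M"
    by (intro sets.sets_Collect_countable_Ex' borel_measurable_less borel_measurable_const XK K)
  \<comment> \<open>Contrapositive of separability with the closed interval \<open>{..u}\<close>: a
    path that stays in it on \<open>I \<inter> D\<close> and at the points of \<open>E\<close> stays
    in it on all of \<open>J\<close>, unless it belongs to \<open>Q\<close>.\<close>
  have sub: "{\<omega> \<in> space M. (SUP t\<in>J. ereal (X t \<omega>)) > ereal u} \<subseteq> ?B \<union> Q"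
  proof
    fix \<omega> assume \<omega>: "\<omega> \<in> {\<omega> \<in> space M. (SUP t\<in>J. ereal (X t \<omega>)) > ereal u}"
    then obtain t where t: "t \<in> J" "u < X t \<omega>" by (auto simp: less_SUP_iff)
    show "\<omega> \<in> ?B \<union> Q"
    proof (rule ccontr)
      assume n: "\<omega> \<notin> ?B \<union> Q"
      have "is_interval {..u}" by (auto simp: is_interval_1)
      then have "(\<forall>t\<in>I \<inter> D. X t \<omega> \<in> {..u}) \<longleftrightarrow> (\<forall>t\<in>I \<inter> {0..}. X t \<omega> \<in> {..u})"
        using DQ I \<omega> n closed_atMost[of u] by blast
      moreover have "X t' \<omega> \<le> u" if "t' \<in> K" for t'
        using n \<omega> that by (auto simp: not_less)
      ultimately have "X t \<omega> \<le> u" using t(1) unfolding K_def JE by blast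
      then show False using t(2) by simp
    qed
  qed
  have "emeasure (completion M) {\<omega> \<in> space M. (SUP t\<in>J. ereal (X t \<omega>)) > ereal u} \<le>
      emeasure (completion M) (?B \<union> Q)"
    using B Q by (intro emeasure_mono sub) auto
  \<comment> \<open>The enclosing set is measurable in \<open>M\<close> itself, where the completion
    has the same values.\<close>
  also have "\<dots> = emeasure M (?B \<union> Q)"
    using B Q by (simp add: main_part_sets null_setsD2 sets.Un)
  also have "\<dots> = emeasure M ?B"
    by (rule emeasure_Un_null_set[OF B Q])
  also have "\<dots> \<le> ennreal (exp (- h * u)) * (SUP t\<in>J. \<integral>\<^sup>+ \<omega>. ennreal (exp (h * X t \<omega>)) \<partial>M)"
    by (rule countable_exponential_maximal_inequality[OF incr X0 XK K J0 h])
  finally show ?thesis .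
qed

section \<open>Application to the ruin probabilities\<close>

text \<open>Both inequalities are strict, so each holds exactly when some single time witnesses it,
  and the two conditions at that time agree.\<close>

lemma ruin_event_eq:
  "{\<omega> \<in> space M. (INF t\<in>J. ereal (risk_reserve N Z p u t \<omega>)) < 0} =
   {\<omega> \<in> space M. (SUP t\<in>J. ereal (claim_surplus N Z p t \<omega>)) > ereal u}"
proof -
  have "risk_reserve N Z p u t \<omega> < 0 \<longleftrightarrow> claim_surplus N Z p t \<omega> > u" for t \<omega>
    by (auto simp: risk_reserve_def claim_surplus_def)
  then show ?thesis by (simp add: INF_less_iff less_SUP_iff)
qed

text \<open>Only an inequality in general, because \<open>measure\<close> has the value 0 where
  \<open>emeasure\<close> is infinite.\<close>

lemma ennreal_measure_le_emeasure: "ennreal (measure M A) \<le> emeasure M A"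
  by (simp add: measure_def ennreal_enn2real_if)

theorem theorem2p2:
  fixes M :: "'a measure" and N :: "real \<Rightarrow> 'a \<Rightarrow> nat" and \<Lambda> :: "real \<Rightarrow> real"
    and Z :: "real \<Rightarrow> 'a \<Rightarrow> real" and p :: "real \<Rightarrow> real" and S :: "real \<Rightarrow> 'a \<Rightarrow> real"
  assumes model: "risk_model M N \<Lambda> Z p"
    and S_def: "S = claim_surplus N Z p"
    and separable: "separable_process M S"
    and increments: "independent_increments M S"
  shows "(\<forall>u>0. \<forall>T\<ge>0. \<forall>h\<ge>0.
            finite_ruin_prob M N Z p u T =
              measure (completion M) {\<omega> \<in> space M. (SUP t\<in>{0..T}. ereal (S t \<omega>)) > ereal u} \<and>
            ennreal (finite_ruin_prob M N Z p u T)
              \<le> ennreal (exp (- h * u)) *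
                (SUP t\<in>{0..T}. \<integral>\<^sup>+ \<omega>. ennreal (exp (h * S t \<omega>)) \<partial>M)) \<and>
         (\<forall>u>0. \<forall>h\<ge>0.
            ruin_prob M N Z p u =
              measure (completion M) {\<omega> \<in> space M. (SUP t\<in>{0..}. ereal (S t \<omega>)) > ereal u} \<and>
            ennreal (ruin_prob M N Z p u)
              \<le> ennreal (exp (- h * u)) *
                (SUP t\<in>{0..}. \<integral>\<^sup>+ \<omega>. ennreal (exp (h * S t \<omega>)) \<partial>M))"
proof -
  interpret risk_model M N \<Lambda> Z p by (fact model)
  \<comment> \<open>At time 0 the claim sum is empty because \<open>N 0 \<omega> = 0\<close>, and
    \<open>p 0 = 0\<close>.\<close>
  have S0: "S 0 \<omega> = 0" if "\<omega> \<in> space M" for \<omega>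
    using poisson premium that
    by (auto simp: S_def claim_surplus_def nonhomogeneous_poisson_process_def)
  have bound: "ennreal (measure (completion M) {\<omega> \<in> space M. (SUP t\<in>J. ereal (S t \<omega>)) > ereal u}) \<le>
      ennreal (exp (- h * u)) * (SUP t\<in>J. \<integral>\<^sup>+ \<omega>. ennreal (exp (h * S t \<omega>)) \<partial>M)"
    if "J = {0..} \<or> (\<exists>T\<ge>0. J = {0..T})" "0 \<le> h" for J u h
    using separable_exponential_maximal_inequality[OF separable increments S0 that]
    by (rule order_trans[OF ennreal_measure_le_emeasure])
  show ?thesis
    \<comment> \<open>Once the ruin events are rewritten as surplus events, the claimed equalities
      are reflexive and only \<open>bound\<close> remains.\<close>
    unfolding finite_ruin_prob_def ruin_prob_def ruin_event_eq S_def[symmetric]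
    by (intro conjI allI impI refl bound) auto
qed

end
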